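(* Assume that the learned drift satisfies $\widehat F_M\in C^1(\mathcal B_\ast;H)$, and let $F_M:\mathbb R^d\to\mathbb R^d$ denote a global cutoff extension (see context) satisfying $F_M\equiv\widehat F_M$ on $\mathcal B_\ast$. Put $$\varepsilon_M^F:=\sup_{z\in\mathcal B_\ast}\|\widehat F_M(z)-F(z)\|_H,\qquad \eta_M^F:=\sup_{z\in\mathcal B_\ast}\|D\widehat F_M(z)-DF(z)\|_{\mathcal L(H,H)},$$ and, with $r_M:=F_M-F$, $$\delta_M:=\sup_{z\in\mathcal B_\ast}\|r_M(z)\|_H,\qquad \ell_M:=\sup_{z\ne z'\in\mathcal B_\ast}\frac{\|r_M(z')-r_M(z)\|_H}{\|z'-z\|_H}.$$ Then $$\delta_M\le\varepsilon_M^F,\qquad \ell_M\le\eta_M^F .$$ Consequently, under the structural and cutoff assumptions of the context, if $$\mu>2(C_{\rm sq}+\eta_M^F),\qquad \mu c_0^2h^2<\nu,$$ then the residual conditions $\delta_M,\ell_M<\infty$, $\mu>2(C_{\rm sq}+\ell_M)$, $\mu c_0^2h^2<\nu$ of the surrogate tracking theorem are satisfied. In particular, the surrogate nudged dynamics converges exponentially to the truth up to the error floor of that theorem with $\delta_M,\ell_M$ replaced by $\varepsilon_M^F,\eta_M^F$: with $\gamma:=\mu-2(C_{\rm sq}+\eta_M^F)$ and $\nu_{\rm eff}:=\nu-\frac{\mu c_0^2h^2}2$, the solutions $u,v$ of $\dot u=F(u)$, $u(0)=u_0$, and $\dot v=F_M(v)-\mu(I_hv-I_hu)$, $v(0)=v_0$,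 with arbitrary $u_0,v_0\in\mathbb R^d$, satisfy, for every $t\ge T_\ast$, $$\|v(t)-u(t)\|_H^2\le e^{-\gamma(t-T_\ast)}\|v(T_\ast)-u(T_\ast)\|_H^2+\frac{(\varepsilon_M^F)^2}{\lambda_1\nu_{\rm eff}\gamma}\bigl(1-e^{-\gamma(t-T_\ast)}\bigr),$$ and hence $\limsup_{t\to\infty}\|v(t)-u(t)\|_H^2\le\frac{(\varepsilon_M^F)^2}{\lambda_1\nu_{\rm eff}\gamma}$.
   Context: $H=\mathbb R^d$ with Euclidean inner product $\langle z,z'\rangle_H=z^\top z'$ and norm $\|\cdot\|_H$; $\mathcal L(H,H)$ carries the operator norm. $\nu>0$, $f\in\mathbb R^d$, $A\in\mathbb R^{d\times d}$, $N:\mathbb R^d\to\mathbb R^d$, $F(z):=f-\nu Az-N(z)$, and $DF$ is the derivative of $F$. Structural assumptions. - $A$ is symmetric positive definite; $\lambda_1>0$ is its smallest eigenvalue, $\|z\|_V:=\sqrt{z^\top Az}$. - There are $\alpha>0$, $\beta\ge0$ with $\nu z^\top Az+\langle N(z),z\rangle_H\ge \alpha\|z\|_H^2-\beta$ for all $z$. - $N$ is locally Lipschitz; there is $C_{\mathrm E}\ge0$ with $\langle N(z),z\rangle_H\ge -C_{\mathrm E}\|z\|_H^2$ for all $z$; for every $R>0$ there is a constant $C_R\ge0$ (local monotonicity constant) with $-\langle N(z')-N(z),z'-z\rangle_H\le C_R\|z'-z\|_H^2$ whenever $\|z\|_H,\|z'\|_H\le R$. - For each $h\in[0,1]$, $I_h:\mathbb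 R^d\to\mathbb R^d$ is linear and $\|z-I_hz\|_H\le c_0h\|z\|_V$ for all $z$, with $c_0>0$ independent of $z,h$; consequently there is $C_I>0$, independent of $h$, with $\|I_hz\|_H\le C_I\|z\|_H$. Here $h\in[0,1]$ is fixed. Cutoff assumptions. $\mu>0$; $R_{\rm ext}^+>R_{\rm ext}>0$; $\psi\in C^\infty([0,\infty);[0,1])$ with $\psi(r)=1$ for $r\le R_{\rm ext}^2$, $\psi(r)=0$ for $r\ge(R_{\rm ext}^+)^2$; $\chi(z):=\psi(\|z\|_V^2)$; $B\in\mathbb R^{d\times d}$ is symmetric positive definite with $\lambda_{\min}(B)-\mu C_I>0$. $\widehat F_M$ is defined and locally Lipschitz on an open neighborhood of $\{\|z\|_V\le R_{\rm ext}^+\}$, and $F_M(z):=\chi(z)\widehat F_M(z)+(1-\chi(z))(f-Bz)$, the first term being $0$ wherever $\chi=0$. Post-absorption ball. Under the structural and cutoff assumptions, for every $(u_0,v_0)$ the solutions $u,v$ exist globally and uniquely, and there exist constants $T_\ast\ge0$, $R_\ast>0$ with $\sup_{t\ge T_\ast}\|u(t)\|_V\le R_\ast$ and $\sup_{t\ge T_\ast}\|v(t)\|_V\le R_\ast$ (a consequence of those assumptions, not a further one). $T_\ast,R_\ast$ denote these constants and $\mathcal B_\ast:=\{z:\|z\|_V\le R_\ast\}$. The cutoff radii are required to be chosen so that $R_\ast\le R_{\rm ext}$, which gives $F_M\equiv\widehat F_M$ on $\mathcal B_\ast$. $C_{\rm sq}:=C_{R_\ast/\sqrt{\lambda_1}}$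 is the local monotonicity constant of $N$ on the $H$-ball of radius $R_\ast/\sqrt{\lambda_1}$. *)

theory Defs
  imports "HOL-Analysis.Analysis"
begin

definition sym_pos_def :: "real ^ 'n ^ 'n \<Rightarrow> bool" where
  "sym_pos_def A \<longleftrightarrow> transpose A = A \<and> (\<forall>z. z \<noteq> 0 \<longrightarrow> z \<bullet> (A *v z) > 0)"

definition is_eigenvalue :: "real ^ 'n ^ 'n \<Rightarrow> real \<Rightarrow> bool" where
  "is_eigenvalue A l \<longleftrightarrow> (\<exists>x. x \<noteq> 0 \<and> A *v x = l *\<^sub>R x)"

text \<open>Only applied to symmetric matrices, whose real spectrum is finite and nonempty.\<close>

definition min_eigenvalue :: "real ^ 'n ^ 'n \<Rightarrow> real" where
  "min_eigenvalue A = (LEAST l. is_eigenvalue A l)"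

definition vnorm :: "real ^ 'n ^ 'n \<Rightarrow> real ^ 'n \<Rightarrow> real" where
  "vnorm A z = sqrt (z \<bullet> (A *v z))"

definition vball :: "real ^ 'n ^ 'n \<Rightarrow> real \<Rightarrow> (real ^ 'n) set" where
  "vball A R = {z. vnorm A z \<le> R}"

text \<open>The library predicate is for time-dependent families; the time argument is vacuous here.\<close>

definition locally_lipschitz_on :: "'a::metric_space set \<Rightarrow> ('a \<Rightarrow> 'b::metric_space) \<Rightarrow> bool" where
  "locally_lipschitz_on S g \<longleftrightarrow> local_lipschitz (UNIV :: real set) S (\<lambda>_. g)"

text \<open>On a closed ball, derivatives are taken relative to the ball; this only matters at
  boundary points, and the relative derivative is unique because the ball is a convex body.\<close>

definition C1_on :: "'a::real_normed_vector set \<Rightarrow> ('a \<Rightarrow> 'b::real_normed_vector) \<Rightarrow> bool" where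
  "C1_on S g \<longleftrightarrow> (\<exists>Dg :: 'a \<Rightarrow> 'a \<Rightarrow>\<^sub>L 'b. continuous_on S Dg \<and>
      (\<forall>z\<in>S. (g has_derivative blinfun_apply (Dg z)) (at z within S)))"

text \<open>Smoothness on the closed half-line, with one-sided derivatives at the origin;
  \<open>D k\<close> is the derivative of order \<open>k\<close>.\<close>

definition smooth_on_halfline :: "(real \<Rightarrow> real) \<Rightarrow> bool" where
  "smooth_on_halfline p \<longleftrightarrow> (\<exists>D :: nat \<Rightarrow> real \<Rightarrow> real. (\<forall>r\<ge>0. D 0 r = p r) \<and>
      (\<forall>k. \<forall>r\<ge>0. (D k has_real_derivative D (Suc k) r) (at r within {0..})))"

text \<open>Suprema are taken in the extended reals, so that unboundedness is visible as \<open>\<infinity>\<close>.\<close>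

definition sup_diff :: "'a set \<Rightarrow> ('a \<Rightarrow> 'b::real_normed_vector) \<Rightarrow> ('a \<Rightarrow> 'b) \<Rightarrow> ereal" where
  "sup_diff S G F = (SUP z\<in>S. ereal (norm (G z - F z)))"

definition sup_deriv_diff ::
    "'a::real_normed_vector set \<Rightarrow> ('a \<Rightarrow> 'b::real_normed_vector) \<Rightarrow> ('a \<Rightarrow> 'b) \<Rightarrow> ereal" where
  "sup_deriv_diff S G F = (SUP z\<in>S. ereal (onorm (\<lambda>x.
      frechet_derivative G (at z within S) x - frechet_derivative F (at z) x)))"

definition sup_diff_quotient ::
    "'a::real_normed_vector set \<Rightarrow> ('a \<Rightarrow> 'b::real_normed_vector) \<Rightarrow> ereal" where
  "sup_diff_quotient S r = (SUP (z, z') \<in> {(z, z'). z \<in> S \<and> z' \<in> S \<and> z \<noteq> z'}.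
      ereal (norm (r z' - r z) / norm (z' - z)))"

definition ivp_solution ::
    "(real \<Rightarrow> 'a::real_normed_vector \<Rightarrow> 'a) \<Rightarrow> 'a \<Rightarrow> (real \<Rightarrow> 'a) \<Rightarrow> bool" where
  "ivp_solution g x0 x \<longleftrightarrow> x 0 = x0 \<and>
      (\<forall>t\<ge>0. (x has_vector_derivative g t (x t)) (at t within {0..}))"

definition drift :: "real \<Rightarrow> real ^ 'n \<Rightarrow> real ^ 'n ^ 'n \<Rightarrow> (real ^ 'n \<Rightarrow> real ^ 'n)
    \<Rightarrow> real ^ 'n \<Rightarrow> real ^ 'n" where
  "drift \<nu> f A N z = f - \<nu> *\<^sub>R (A *v z) - N z"

text \<open>Functions are total, so \<open>Fhat\<close> has arbitrary values outside its domain;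
  the first summand is nevertheless \<open>0\<close> wherever the cutoff vanishes.\<close>

definition cutoff_extension :: "real ^ 'n ^ 'n \<Rightarrow> (real \<Rightarrow> real) \<Rightarrow> real ^ 'n \<Rightarrow> real ^ 'n ^ 'n
    \<Rightarrow> (real ^ 'n \<Rightarrow> real ^ 'n) \<Rightarrow> real ^ 'n \<Rightarrow> real ^ 'n" where
  "cutoff_extension A \<psi> f B Fhat z =
     (let c = \<psi> ((vnorm A z)\<^sup>2) in c *\<^sub>R Fhat z + (1 - c) *\<^sub>R (f - B *v z))"

text \<open>\<open>CR R\<close> is the local monotonicity constant of \<open>N\<close> on the ball of radius \<open>R\<close>, and \<open>I h\<close> is
  the observation operator at resolution \<open>h\<close>.\<close>

locale structural_assumptions =
  fixes \<nu> :: real and A :: "real ^ 'n ^ 'n" and N :: "real ^ 'n \<Rightarrow> real ^ 'n"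
    and \<alpha> \<beta> CE :: real and CR :: "real \<Rightarrow> real"
    and I :: "real \<Rightarrow> real ^ 'n \<Rightarrow> real ^ 'n" and c0 CI h :: real
  assumes nu_pos: "\<nu> > 0"
    and A_spd: "sym_pos_def A"
    and alpha_pos: "\<alpha> > 0" and beta_nonneg: "\<beta> \<ge> 0"
    and coercive: "\<And>z. \<nu> * (z \<bullet> (A *v z)) + N z \<bullet> z \<ge> \<alpha> * (norm z)\<^sup>2 - \<beta>"
    and N_lipschitz: "locally_lipschitz_on UNIV N"
    and CE_nonneg: "CE \<ge> 0" and N_lower: "\<And>z. N z \<bullet> z \<ge> - CE * (norm z)\<^sup>2"
    and CR_nonneg: "\<And>R. R > 0 \<Longrightarrow> CR R \<ge> 0"
    and N_monotone: "\<And>R z z'. R > 0 \<Longrightarrow> norm z \<le> R \<Longrightarrow> norm z' \<le> R \<Longrightarrow>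
          - ((N z' - N z) \<bullet> (z' - z)) \<le> CR R * (norm (z' - z))\<^sup>2"
    and c0_pos: "c0 > 0"
    and I_linear: "\<And>k. k \<in> {0..1} \<Longrightarrow> linear (I k)"
    and I_approx: "\<And>k z. k \<in> {0..1} \<Longrightarrow> norm (z - I k z) \<le> c0 * k * vnorm A z"
    and CI_pos: "CI > 0"
    and I_bound: "\<And>k z. k \<in> {0..1} \<Longrightarrow> norm (I k z) \<le> CI * norm z"
    and h_range: "h \<in> {0..1}"

locale cutoff_assumptions =
  fixes A :: "real ^ 'n ^ 'n" and CI \<mu> Rext Rext' :: real and \<psi> :: "real \<Rightarrow> real"
    and B :: "real ^ 'n ^ 'n" and Fhat :: "real ^ 'n \<Rightarrow> real ^ 'n"
  assumes mu_pos: "\<mu> > 0"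
    and radii: "0 < Rext" "Rext < Rext'"
    and psi_smooth: "smooth_on_halfline \<psi>"
    and psi_range: "\<And>r. r \<ge> 0 \<Longrightarrow> \<psi> r \<in> {0..1}"
    and psi_inner: "\<And>r. 0 \<le> r \<Longrightarrow> r \<le> Rext\<^sup>2 \<Longrightarrow> \<psi> r = 1"
    and psi_outer: "\<And>r. r \<ge> Rext'\<^sup>2 \<Longrightarrow> \<psi> r = 0"
    and B_spd: "sym_pos_def B"
    and B_dissipative: "min_eigenvalue B - \<mu> * CI > 0"
    and Fhat_lipschitz: "\<exists>U. open U \<and> vball A Rext' \<subseteq> U \<and> locally_lipschitz_on U Fhat"

end

theory Submission
  imports Defs "HOL-Real_Asymp.Real_Asymp"
begin

text \<open>The residual \<open>r = FM - F\<close> is differentiable relative to the convex ball, so the mean value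
  inequality bounds its difference quotients by the supremum of the operator norm of its derivative.
  For the error \<open>w = v - u\<close>, monotonicity of \<open>N\<close>, the splitting \<open>r(v) = (r(v) - r(u)) + r(u)\<close> and the
  interpolation estimate for \<open>w - I h w\<close> give
  \<open>(\<parallel>w\<parallel>\<^sup>2)' \<le> - \<gamma> \<parallel>w\<parallel>\<^sup>2 - 2 nueff \<parallel>w\<parallel>\<^sub>V\<^sup>2 + 2 \<epsilon> \<parallel>w\<parallel>\<close>, whose last term is absorbed using
  \<open>lam1 \<parallel>w\<parallel>\<^sup>2 \<le> \<parallel>w\<parallel>\<^sub>V\<^sup>2\<close>; Gronwall's inequality concludes. The absorbing ball comes from Gronwall's
  inequality for \<open>\<parallel>u\<parallel>\<^sup>2\<close> and \<open>\<parallel>v\<parallel>\<^sup>2\<close>.\<close>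

section \<open>Symmetric matrices and the energy norm\<close>

lemma symmetric_matrix_inner:
  fixes A :: "real ^ 'n ^ 'n"
  assumes "transpose A = A"
  shows "x \<bullet> (A *v y) = y \<bullet> (A *v x)"
  by (metis assms dot_lmul_matrix inner_commute transpose_matrix_vector)

lemma quadratic_form_add_scaleR:
  fixes A :: "real ^ 'n ^ 'n"
  assumes "transpose A = A"
  shows "(x + t *\<^sub>R y) \<bullet> (A *v (x + t *\<^sub>R y)) =
    x \<bullet> (A *v x) + 2 * t * (y \<bullet> (A *v x)) + t\<^sup>2 * (y \<bullet> (A *v y))"
  using symmetric_matrix_inner[OF assms, of x y]
  by (simp add: matrix_vector_right_distrib matrix_vector_mult_scaleR inner_add_left inner_add_right
      power2_eq_square algebra_simps)

text \<open>First-order optimality in scalar form: for small \<open>t\<close> of sign opposite to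
  \<open>a\<close> the linear term dominates and would make the expression negative.\<close>

lemma linear_term_eq_0:
  fixes a K :: real
  assumes nonneg: "\<And>t. 2 * t * a + t\<^sup>2 * K \<ge> 0"
  shows "a = 0"
proof (rule ccontr)
  assume "a \<noteq> 0"
  \<comment> \<open>This scale gives \<open>s * K \<le> 1\<close>, below the 2 contributed by the
    linear term at \<open>t = - (s * a)\<close>, whatever the sign of \<open>K\<close>.\<close>
  define s where "s = 1 / (\<bar>K\<bar> + 1)"
  have s: "s > 0" "s * K \<le> 1"
    by (auto simp: s_def divide_simps)
  have "0 \<le> 2 * (- (s * a)) * a + (- (s * a))\<^sup>2 * K"
    by (rule nonneg)
  also have "\<dots> = s * a\<^sup>2 * (s * K - 2)"
    by (simp add: power2_eq_square algebra_simps)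
  also have "\<dots> < 0"
    using s \<open>a \<noteq> 0\<close> by (intro mult_pos_neg) auto
  finally show False by simp
qed

text \<open>The quadratic form attains its minimum on the compact unit sphere, homogeneity extends
  the lower bound to all vectors, and stationarity at the minimizer is the eigenvector
  equation.\<close>

lemma symmetric_matrix_rayleigh_min:
  fixes A :: "real ^ 'n ^ 'n"
  assumes sym: "transpose A = A"
  obtains x where "norm x = 1" "A *v x = (x \<bullet> (A *v x)) *\<^sub>R x"
    "\<And>z. (x \<bullet> (A *v x)) * (norm z)\<^sup>2 \<le> z \<bullet> (A *v z)"
proof -
  have "continuous_on (sphere 0 1) (\<lambda>z :: real ^ 'n. z \<bullet> (A *v z))"
    by (intro continuous_intros)
  then obtain x :: "real ^ 'n" where x: "x \<in> sphere 0 1"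
    and min: "\<And>y. y \<in> sphere 0 1 \<Longrightarrow> x \<bullet> (A *v x) \<le> y \<bullet> (A *v y)"
    using continuous_attains_inf[of "sphere (0 :: real ^ 'n) 1" "\<lambda>z. z \<bullet> (A *v z)"] by auto
  define m where "m = x \<bullet> (A *v x)"
  have bound: "m * (norm z)\<^sup>2 \<le> z \<bullet> (A *v z)" for z
  proof (cases "z = 0")
    case False
    have "m \<le> (z /\<^sub>R norm z) \<bullet> (A *v (z /\<^sub>R norm z))"
      unfolding m_def using False by (intro min) simp
    also have "\<dots> = (z \<bullet> (A *v z)) / (norm z)\<^sup>2"
      by (simp add: matrix_vector_mult_scaleR power2_eq_square divide_simps)
    finally show ?thesis
      using False by (simp add: divide_simps)
  qed simp
  \<comment> \<open>\<open>w\<close> is the defect in the eigenvector equation. When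
    \<open>x\<close> is perturbed along \<open>w\<close> itself, the order-zero terms cancel and
    \<open>w \<bullet> w\<close> is left as the linear coefficient, so it must vanish.\<close>
  define w where "w = A *v x - m *\<^sub>R x"
  have "2 * t * (w \<bullet> w) + t\<^sup>2 * (w \<bullet> (A *v w) - m * (w \<bullet> w)) \<ge> 0" for t
  proof -
    have "m * (norm (x + t *\<^sub>R w))\<^sup>2 \<le> (x + t *\<^sub>R w) \<bullet> (A *v (x + t *\<^sub>R w))"
      by (rule bound)
    moreover have "(norm (x + t *\<^sub>R w))\<^sup>2 = 1 + 2 * t * (w \<bullet> x) + t\<^sup>2 * (w \<bullet> w)"
      using x unfolding power2_norm_eq_inner
      by (simp add: inner_add_left inner_add_right norm_eq_1 inner_commute power2_eq_square
          algebra_simps)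
    moreover have "w \<bullet> (A *v x) = w \<bullet> w + m * (w \<bullet> x)"
      by (subst (3) w_def) (simp add: inner_diff_right)
    ultimately have "m * (1 + 2 * t * (w \<bullet> x) + t\<^sup>2 * (w \<bullet> w))
        \<le> m + 2 * t * (w \<bullet> w + m * (w \<bullet> x)) + t\<^sup>2 * (w \<bullet> (A *v w))"
      unfolding quadratic_form_add_scaleR[OF sym] by (simp add: m_def)
    then show ?thesis
      by (simp add: algebra_simps)
  qed
  then have "w \<bullet> w = 0"
    by (rule linear_term_eq_0)
  then show thesis
    using that[of x] x bound by (auto simp: w_def m_def)
qed

text \<open>The Rayleigh minimum is an eigenvalue, and its lower bound tested on eigenvectors shows
  that none is smaller. Hence the \<open>LEAST\<close> in \<open>min_eigenvalue\<close> is attained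
  and inherits the variational bound.\<close>

lemma min_eigenvalue_bound:
  assumes "transpose A = A"
  shows "min_eigenvalue A * (norm z)\<^sup>2 \<le> z \<bullet> (A *v z)"
    and "is_eigenvalue A (min_eigenvalue A)"
proof -
  obtain x where x: "norm x = 1" "A *v x = (x \<bullet> (A *v x)) *\<^sub>R x"
    and bound: "\<And>z. (x \<bullet> (A *v x)) * (norm z)\<^sup>2 \<le> z \<bullet> (A *v z)"
    using symmetric_matrix_rayleigh_min[OF assms] by metis
  have ev: "is_eigenvalue A (x \<bullet> (A *v x))"
    unfolding is_eigenvalue_def using x by (intro exI[of _ x]) auto
  have "x \<bullet> (A *v x) \<le> l" if l: "is_eigenvalue A l" for l
  proof -
    obtain y where y: "y \<noteq> 0" "A *v y = l *\<^sub>R y"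
      using l unfolding is_eigenvalue_def by blast
    then show ?thesis
      using bound[of y] by (simp add: power2_norm_eq_inner)
  qed
  with ev have "min_eigenvalue A = x \<bullet> (A *v x)"
    unfolding min_eigenvalue_def by (intro Least_equality)
  then show "min_eigenvalue A * (norm z)\<^sup>2 \<le> z \<bullet> (A *v z)" "is_eigenvalue A (min_eigenvalue A)"
    using bound ev by auto
qed

lemma min_eigenvalue_pos:
  assumes "sym_pos_def A"
  shows "min_eigenvalue A > 0"
proof -
  obtain x where "x \<noteq> 0" "A *v x = min_eigenvalue A *\<^sub>R x"
    using assms min_eigenvalue_bound(2)[of A] unfolding sym_pos_def_def is_eigenvalue_def by blast
  moreover from this have "0 < x \<bullet> (A *v x)"
    using assms unfolding sym_pos_def_def by blast
  ultimately show ?thesis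
    by (simp add: zero_less_mult_iff) (metis inner_ge_zero not_less)
qed

section \<open>Comparison of the energy norm with the Euclidean norm\<close>

lemma sym_pos_def_nonneg: "sym_pos_def A \<Longrightarrow> 0 \<le> z \<bullet> (A *v z)"
  unfolding sym_pos_def_def by (cases "z = 0") (auto intro: less_imp_le)

lemma vnorm_power2: "sym_pos_def A \<Longrightarrow> (vnorm A z)\<^sup>2 = z \<bullet> (A *v z)"
  unfolding vnorm_def by (simp add: sym_pos_def_nonneg)

lemma vnorm_nonneg: "sym_pos_def A \<Longrightarrow> 0 \<le> vnorm A z"
  unfolding vnorm_def by (simp add: sym_pos_def_nonneg)

lemma min_eigenvalue_vnorm_bound:
  assumes "sym_pos_def A"
  shows "min_eigenvalue A * (norm z)\<^sup>2 \<le> (vnorm A z)\<^sup>2"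
  using assms min_eigenvalue_bound(1)[of A z] by (simp add: vnorm_power2 sym_pos_def_def)

text \<open>Places the energy ball of radius \<open>R\<close> inside the Euclidean ball of radius
  \<open>R / sqrt (min_eigenvalue A)\<close>, the kind of radius at which the monotonicity constant
  is evaluated.\<close>

lemma norm_le_vnorm:
  assumes "sym_pos_def A"
  shows "norm z \<le> vnorm A z / sqrt (min_eigenvalue A)"
proof -
  have "sqrt (min_eigenvalue A * (norm z)\<^sup>2) \<le> sqrt ((vnorm A z)\<^sup>2)"
    using min_eigenvalue_vnorm_bound[OF assms] by (rule real_sqrt_le_mono)
  then show ?thesis
    using min_eigenvalue_pos[OF assms] vnorm_nonneg[OF assms, of z]
    by (simp add: real_sqrt_mult field_simps)
qed

text \<open>The converse comparison, by Cauchy-Schwarz and boundedness of \<open>A\<close>. It turns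
  Euclidean bounds on trajectories into an absorbing energy ball.\<close>

lemma vnorm_le_norm:
  fixes A :: "real ^ 'n ^ 'n"
  obtains K where "K > 0" "\<And>z. vnorm A z \<le> K * norm z"
proof -
  obtain K where K: "K > 0" "\<And>z. norm (A *v z) \<le> norm z * K"
    using bounded_linear.pos_bounded[OF matrix_vector_mul_bounded_linear[of A]] by blast
  have "vnorm A z \<le> sqrt K * norm z" for z
  proof -
    have "z \<bullet> (A *v z) \<le> norm z * norm (A *v z)"
      by (rule norm_cauchy_schwarz)
    also have "\<dots> \<le> norm z * (norm z * K)"
      by (intro mult_left_mono K) auto
    finally have "z \<bullet> (A *v z) \<le> K * (norm z)\<^sup>2"
      by (simp add: power2_eq_square algebra_simps)
    then have "sqrt (z \<bullet> (A *v z)) \<le> sqrt (K * (norm z)\<^sup>2)"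
      by (rule real_sqrt_le_mono)
    then show ?thesis
      unfolding vnorm_def by (simp add: real_sqrt_mult)
  qed
  with K that[of "sqrt K"] show thesis by simp
qed

section \<open>Compactness and convexity of energy balls\<close>

lemma compact_vball:
  assumes "sym_pos_def A"
  shows "compact (vball A R)"
proof -
  have "bounded (vball A R)"
    unfolding bounded_iff vball_def
  proof (intro exI ballI)
    fix z assume "z \<in> {z. vnorm A z \<le> R}"
    then have "vnorm A z / sqrt (min_eigenvalue A) \<le> R / sqrt (min_eigenvalue A)"
      using min_eigenvalue_pos[OF assms] by (intro divide_right_mono) auto
    then show "norm z \<le> R / sqrt (min_eigenvalue A)"
      using norm_le_vnorm[OF assms, of z] by linarith
  qed
  moreover have "closed (vball A R)"
    unfolding vball_def vnorm_def by (intro closed_Collect_le continuous_intros)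
  ultimately show ?thesis
    by (simp add: compact_eq_bounded_closed)
qed

lemma mem_vball_iff:
  assumes "sym_pos_def A" "R \<ge> 0"
  shows "z \<in> vball A R \<longleftrightarrow> z \<bullet> (A *v z) \<le> R\<^sup>2"
  using assms unfolding vball_def vnorm_def
  by (auto intro: real_le_lsqrt dest: sqrt_le_D simp: sym_pos_def_nonneg)

lemma convex_vball:
  assumes spd: "sym_pos_def A" and "R \<ge> 0"
  shows "convex (vball A R)"
proof (rule convexI)
  fix x y and a b :: real
  assume xy: "x \<in> vball A R" "y \<in> vball A R" and ab: "0 \<le> a" "0 \<le> b" "a + b = 1"
  have sym: "transpose A = A"
    using spd by (simp add: sym_pos_def_def)
  have a: "a = 1 - b"
    using ab by simp
  \<comment> \<open>For \<open>a + b = 1\<close> the cross terms complete to the quadratic form of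
    \<open>x - y\<close>, which enters with the nonpositive factor \<open>- a * b\<close>.\<close>
  have "(a *\<^sub>R x + b *\<^sub>R y) \<bullet> (A *v (a *\<^sub>R x + b *\<^sub>R y)) =
      a * (x \<bullet> (A *v x)) + b * (y \<bullet> (A *v y)) - a * b * ((x - y) \<bullet> (A *v (x - y)))"
    using symmetric_matrix_inner[OF sym, of x y] unfolding a
    by (simp add: matrix_vector_right_distrib matrix_vector_mult_diff_distrib
        matrix_vector_mult_scaleR inner_add_left inner_add_right inner_diff_left inner_diff_right
        algebra_simps)
  also have "\<dots> \<le> a * (x \<bullet> (A *v x)) + b * (y \<bullet> (A *v y))"
    using ab sym_pos_def_nonneg[OF spd, of "x - y"] by simp
  also have "\<dots> \<le> a * R\<^sup>2 + b * R\<^sup>2"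
    using xy ab by (intro add_mono mult_left_mono) (auto simp: mem_vball_iff[OF assms])
  also have "\<dots> = R\<^sup>2"
    unfolding a by (simp add: algebra_simps)
  finally show "a *\<^sub>R x + b *\<^sub>R y \<in> vball A R"
    by (simp add: mem_vball_iff[OF assms])
qed

section \<open>Residual suprema\<close>

lemma sup_diff_nonneg: "S \<noteq> {} \<Longrightarrow> 0 \<le> sup_diff S G F"
  unfolding sup_diff_def by (meson SUP_upper2 all_not_in_conv ereal_less_eq(5) norm_ge_zero)

lemma sup_deriv_diff_upper:
  "z \<in> S \<Longrightarrow> ereal (onorm (\<lambda>x. frechet_derivative G (at z within S) x - frechet_derivative F (at z) x))
    \<le> sup_deriv_diff S G F"
  unfolding sup_deriv_diff_def by (rule SUP_upper)

lemma has_derivative_residual: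
  assumes "G differentiable (at z within S)" "F differentiable (at z)"
  shows "((\<lambda>z. G z - F z) has_derivative
    (\<lambda>x. frechet_derivative G (at z within S) x - frechet_derivative F (at z) x)) (at z within S)"
  using assms
  by (intro has_derivative_diff) (simp_all add: frechet_derivative_works has_derivative_at_withinI)

lemma sup_deriv_diff_nonneg:
  assumes "z \<in> S" "G differentiable (at z within S)" "F differentiable (at z)"
  shows "0 \<le> sup_deriv_diff S G F"
proof -
  have "0 \<le> onorm (\<lambda>x. frechet_derivative G (at z within S) x - frechet_derivative F (at z) x)"
    using has_derivative_residual[OF assms(2,3)] by (intro onorm_pos_le has_derivative_bounded_linear)
  then show ?thesis
    using sup_deriv_diff_upper[OF assms(1), of G F]
    by (meson ereal_less_eq(5) order_trans)
qed

text \<open>Convexity keeps the segment from \<open>x\<close> to \<open>y\<close> in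
  \<open>S\<close>, so the mean value inequality applies with derivatives relative to
  \<open>S\<close>, also at boundary points.\<close>

lemma residual_lipschitz:
  assumes "convex S" "\<And>z. z \<in> S \<Longrightarrow> G differentiable (at z within S)"
    "\<And>z. z \<in> S \<Longrightarrow> F differentiable (at z)"
    and fin: "sup_deriv_diff S G F = ereal L" and "x \<in> S" "y \<in> S"
  shows "norm ((G y - F y) - (G x - F x)) \<le> L * norm (y - x)"
proof (rule differentiable_bound[OF \<open>convex S\<close>])
  show "((\<lambda>z. G z - F z) has_derivative
      (\<lambda>x. frechet_derivative G (at z within S) x - frechet_derivative F (at z) x)) (at z within S)"
    if "z \<in> S" for z
    using that assms by (intro has_derivative_residual)
  show "onorm (\<lambda>x. frechet_derivative G (at z within S) x - frechet_derivative F (at z) x) \<le> L"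
    if "z \<in> S" for z
    using sup_deriv_diff_upper[OF that, of G F] by (simp add: fin)
qed (use assms in auto)

text \<open>A finite right-hand side is the Lipschitz estimate, an infinite one is trivial, and
  nonnegativity excludes -\<infinity>.\<close>

lemma sup_diff_quotient_le_sup_deriv_diff:
  assumes "convex S" "S \<noteq> {}" "\<And>z. z \<in> S \<Longrightarrow> G differentiable (at z within S)"
    "\<And>z. z \<in> S \<Longrightarrow> F differentiable (at z)"
  shows "sup_diff_quotient S (\<lambda>z. G z - F z) \<le> sup_deriv_diff S G F"
proof (cases "sup_deriv_diff S G F")
  case (real L)
  show ?thesis
    unfolding sup_diff_quotient_def real
    using residual_lipschitz[OF assms(1,3,4) real]
    by (intro SUP_least) (auto simp: divide_simps)
next
  case MInf
  then show ?thesis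
    using assms sup_deriv_diff_nonneg[of _ S G F] by auto
qed simp

lemma sup_diff_finite:
  assumes "compact S" "continuous_on S G" "continuous_on S F"
  shows "sup_diff S G F < \<infinity>"
proof -
  have "bounded ((\<lambda>z. G z - F z) ` S)"
    using assms by (intro compact_imp_bounded compact_continuous_image continuous_intros)
  then obtain K where "\<And>z. z \<in> S \<Longrightarrow> norm (G z - F z) \<le> K"
    unfolding bounded_iff by auto
  then have "sup_diff S G F \<le> ereal K"
    unfolding sup_diff_def by (intro SUP_least) auto
  then show ?thesis
    by auto
qed

section \<open>Differential inequalities\<close>

text \<open>By the integrating factor, \<open>y s - D / c\<close> multiplied by
  \<open>exp (c * (s - T))\<close> is nonincreasing.\<close>

lemma gronwall_decay:
  fixes y :: "real \<Rightarrow> real"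
  assumes "c > 0"
    and deriv: "\<And>s. s \<ge> T \<Longrightarrow> (y has_real_derivative y' s) (at s within {T..})"
    and le: "\<And>s. s \<ge> T \<Longrightarrow> y' s \<le> D - c * y s"
    and "t \<ge> T"
  shows "y t \<le> exp (- c * (t - T)) * y T + D / c * (1 - exp (- c * (t - T)))"
proof -
  define g where "g s = exp (c * (s - T)) * (y s - D / c)" for s
  have g: "(g has_real_derivative exp (c * (s - T)) * (y' s - (D - c * y s))) (at s within {T..})"
    if "s \<ge> T" for s
    unfolding g_def using \<open>c > 0\<close>
    by (auto intro!: derivative_eq_intros deriv[OF that] simp: field_simps)
  \<comment> \<open>The monotonicity criterion uses two-sided derivatives only inside the interval;
    at \<open>T\<close>, where the derivative is one-sided, it uses continuity.\<close>
  have "g t \<le> g T"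
  proof (rule DERIV_nonpos_imp_decreasing_open[OF \<open>t \<ge> T\<close>])
    fix s assume s: "T < s" "s < t"
    then have "at s within {T..} = at s"
      by (intro at_within_interior) auto
    then have "(g has_real_derivative exp (c * (s - T)) * (y' s - (D - c * y s))) (at s)"
      using g[of s] s by simp
    moreover have "exp (c * (s - T)) * (y' s - (D - c * y s)) \<le> 0"
      using le[of s] s by (intro mult_nonneg_nonpos) auto
    ultimately show "\<exists>z. (g has_real_derivative z) (at s) \<and> z \<le> 0"
      by blast
  next
    have "continuous_on {T..} g"
      using g by (intro DERIV_continuous_on) auto
    then show "continuous_on {T..t} g"
      by (rule continuous_on_subset) auto
  qed
  then have "exp (- (c * (t - T))) * g t \<le> exp (- (c * (t - T))) * g T"
    by (intro mult_left_mono) auto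
  moreover have "exp (- (c * (t - T))) * g t = y t - D / c"
    by (simp add: g_def exp_minus)
  ultimately show ?thesis
    by (simp add: g_def algebra_simps)
qed

lemma gronwall_decay_norm:
  fixes x :: "real \<Rightarrow> 'a::real_inner"
  assumes "c > 0"
    and deriv: "\<And>s. s \<ge> T \<Longrightarrow> (x has_vector_derivative x' s) (at s within {T..})"
    and le: "\<And>s. s \<ge> T \<Longrightarrow> 2 * (x' s \<bullet> x s) \<le> D - c * (norm (x s))\<^sup>2"
    and "t \<ge> T"
  shows "(norm (x t))\<^sup>2 \<le> exp (- c * (t - T)) * (norm (x T))\<^sup>2 + D / c * (1 - exp (- c * (t - T)))"
proof (rule gronwall_decay[OF \<open>c > 0\<close> _ le \<open>t \<ge> T\<close>])
  fix s assume "s \<ge> T"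
  then have "((\<lambda>s. x s \<bullet> x s) has_vector_derivative x s \<bullet> x' s + x' s \<bullet> x s) (at s within {T..})"
    by (intro bounded_bilinear.has_vector_derivative[OF bounded_bilinear_inner] deriv)
  then show "((\<lambda>s. (norm (x s))\<^sup>2) has_real_derivative 2 * (x' s \<bullet> x s)) (at s within {T..})"
    by (simp add: power2_norm_eq_inner has_real_derivative_iff_has_vector_derivative inner_commute)
qed

text \<open>Differentiating the squared norm doubles the damping. One half absorbs the linear term
  by Young's inequality, the other drives Gronwall's inequality.\<close>

lemma dissipative_bounded:
  fixes x :: "real \<Rightarrow> 'a::real_inner"
  assumes "c > 0"
    and deriv: "\<And>s. s \<ge> 0 \<Longrightarrow> (x has_vector_derivative x' s) (at s within {0..})"
    and le: "\<And>s. s \<ge> 0 \<Longrightarrow> x' s \<bullet> x s \<le> M + P * norm (x s) - c * (norm (x s))\<^sup>2"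
  obtains K where "K > 0" "\<And>t. t \<ge> 0 \<Longrightarrow> norm (x t) \<le> K"
proof -
  \<comment> \<open>\<open>P\<^sup>2 / c\<close> is the remainder in
    \<open>2 * P * n \<le> P\<^sup>2 / c + c * n\<^sup>2\<close>. The absolute value in
    \<open>K\<close> covers negative \<open>D\<close>.\<close>
  define D where "D = 2 * M + P\<^sup>2 / c"
  define K where "K = (norm (x 0))\<^sup>2 + \<bar>D / c\<bar>"
  have "(norm (x t))\<^sup>2 \<le> K" if "t \<ge> 0" for t
  proof -
    have "(norm (x t))\<^sup>2 \<le> exp (- c * (t - 0)) * (norm (x 0))\<^sup>2 + D / c * (1 - exp (- c * (t - 0)))"
    proof (rule gronwall_decay_norm[OF \<open>c > 0\<close> deriv _ that])
      fix s :: real assume s: "s \<ge> 0"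
      have "0 \<le> (P - c * norm (x s))\<^sup>2 / c"
        using \<open>c > 0\<close> by simp
      also have "\<dots> = P\<^sup>2 / c - 2 * P * norm (x s) + c * (norm (x s))\<^sup>2"
        using \<open>c > 0\<close> by (simp add: field_simps power2_eq_square)
      finally show "2 * (x' s \<bullet> x s) \<le> D - c * (norm (x s))\<^sup>2"
        using le[OF s] by (simp add: D_def)
    qed
    also have "\<dots> \<le> 1 * (norm (x 0))\<^sup>2 + \<bar>D / c\<bar> * 1"
    proof (intro add_mono mult_right_mono)
      have e: "0 \<le> 1 - exp (- c * (t - 0))" "1 - exp (- c * (t - 0)) \<le> 1"
        using that \<open>c > 0\<close> by auto
      then show "exp (- c * (t - 0)) \<le> 1"
        by simp
      have "D / c * (1 - exp (- c * (t - 0))) \<le> \<bar>D / c\<bar> * (1 - exp (- c * (t - 0)))"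
        using e by (intro mult_right_mono abs_ge_self)
      also have "\<dots> \<le> \<bar>D / c\<bar> * 1"
        using e by (intro mult_left_mono) auto
      finally show "D / c * (1 - exp (- c * (t - 0))) \<le> \<bar>D / c\<bar> * 1" .
    qed auto
    finally show ?thesis
      by (simp add: K_def)
  qed
  then have "norm (x t) \<le> sqrt K + 1" if "t \<ge> 0" for t
    using real_le_rsqrt[of "norm (x t)" K] that by fastforce
  moreover have "sqrt K + 1 > 0"
    by (simp add: K_def add_nonneg_pos)
  ultimately show thesis
    using that by blast
qed

section \<open>The nudged dynamics\<close>

context structural_assumptions
begin

section \<open>A priori bounds for the truth and the surrogate\<close>

lemma drift_solution_bounded:
  assumes "ivp_solution (\<lambda>_. drift \<nu> f A N) u0 u"
  obtains K where "K > 0" "\<And>t. t \<ge> 0 \<Longrightarrow> norm (u t) \<le> K"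
proof (rule dissipative_bounded[OF alpha_pos])
  show "(u has_vector_derivative drift \<nu> f A N (u s)) (at s within {0..})" if "s \<ge> 0" for s
    using assms that by (simp add: ivp_solution_def)
  show "drift \<nu> f A N (u s) \<bullet> u s \<le> \<beta> + norm f * norm (u s) - \<alpha> * (norm (u s))\<^sup>2" for s
    using coercive[of "u s"] norm_cauchy_schwarz[of f "u s"]
    by (simp add: drift_def inner_diff_left inner_commute[of "A *v u s"])
qed (rule that)

text \<open>On the outer ball the learned part is bounded by compactness; beyond it the cutoff
  vanishes and the \<open>B\<close> term alone remains. The convex combination keeps the full
  damping rate of \<open>B\<close>.\<close>

lemma cutoff_extension_dissipative:
  assumes "cutoff_assumptions A CI \<mu> Rext Rext' \<psi> B Fhat"
  obtains M where
    "\<And>z. cutoff_extension A \<psi> f B Fhat z \<bullet> z \<le> M + norm f * norm z - min_eigenvalue B * (norm z)\<^sup>2"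
proof -
  interpret cutoff_assumptions A CI \<mu> Rext Rext' \<psi> B Fhat by fact
  define m where "m = min_eigenvalue B"
  obtain U where "vball A Rext' \<subseteq> U" "locally_lipschitz_on U Fhat"
    using Fhat_lipschitz by blast
  then have "continuous_on (vball A Rext') Fhat"
    unfolding locally_lipschitz_on_def
    by (metis UNIV_I continuous_on_subset local_lipschitz_continuous_on)
  \<comment> \<open>With the damping added in advance, the weight \<open>c\<close> here and the
    weight \<open>1 - c\<close> from the \<open>B\<close> part sum to the whole of
    \<open>m * (norm z)\<^sup>2\<close>.\<close>
  then have "compact ((\<lambda>z. Fhat z \<bullet> z + m * (norm z)\<^sup>2) ` vball A Rext')"
    by (intro compact_continuous_image compact_vball[OF A_spd] continuous_intros)
  then obtain M where M: "\<And>z. z \<in> vball A Rext' \<Longrightarrow> \<bar>Fhat z \<bullet> z + m * (norm z)\<^sup>2\<bar> \<le> M"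
    by (metis (no_types, lifting) bounded_real compact_imp_bounded imageI)
  have "vnorm A 0 \<le> Rext'"
    using radii by (simp add: vnorm_def)
  then have "M \<ge> 0"
    using M[of 0] by (simp add: vball_def)
  have "cutoff_extension A \<psi> f B Fhat z \<bullet> z \<le> M + norm f * norm z - m * (norm z)\<^sup>2" for z
  proof -
    define c where "c = \<psi> ((vnorm A z)\<^sup>2)"
    have c: "0 \<le> c" "c \<le> 1"
      using psi_range[of "(vnorm A z)\<^sup>2"] by (auto simp: c_def)
    have "c * (Fhat z \<bullet> z + m * (norm z)\<^sup>2) \<le> M"
    proof (cases "vnorm A z \<le> Rext'")
      case True
      then have "c * (Fhat z \<bullet> z + m * (norm z)\<^sup>2) \<le> 1 * M"
        using M[of z] c by (intro order_trans[OF mult_left_mono mult_right_mono]) (auto simp: vball_def)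
      then show ?thesis by simp
    next
      case False
      then have "c = 0"
        using radii by (simp add: c_def psi_outer power_mono)
      then show ?thesis
        using \<open>M \<ge> 0\<close> by simp
    qed
    moreover have "(1 - c) * (f \<bullet> z - (B *v z) \<bullet> z) \<le> norm f * norm z - (1 - c) * (m * (norm z)\<^sup>2)"
    proof -
      have "m * (norm z)\<^sup>2 \<le> (B *v z) \<bullet> z"
        using B_spd min_eigenvalue_bound(1)[of B z]
        by (simp add: m_def sym_pos_def_def inner_commute)
      then have "(1 - c) * (f \<bullet> z - (B *v z) \<bullet> z) \<le> (1 - c) * (norm f * norm z - m * (norm z)\<^sup>2)"
        using c norm_cauchy_schwarz[of f z] by (intro mult_left_mono) auto
      also have "\<dots> \<le> 1 * (norm f * norm z) - (1 - c) * (m * (norm z)\<^sup>2)"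
        using c mult_right_mono[of "1 - c" 1 "norm f * norm z"] by (simp add: right_diff_distrib)
      finally show ?thesis by simp
    qed
    ultimately show ?thesis
      by (simp add: cutoff_extension_def c_def[symmetric] Let_def inner_add_left inner_diff_left
          algebra_simps)
  qed
  then show thesis
    by (intro that) (simp add: m_def)
qed

text \<open>Since the truth is bounded, nudging adds at most
  \<open>\<mu> * CI * (norm (v s))\<^sup>2\<close> plus a term linear in \<open>norm (v s)\<close>;
  the gap \<open>min_eigenvalue B - \<mu> * CI > 0\<close> leaves net damping.\<close>

lemma nudged_solution_bounded:
  assumes cut: "cutoff_assumptions A CI \<mu> Rext Rext' \<psi> B Fhat"
    and u: "\<And>t. t \<ge> 0 \<Longrightarrow> norm (u t) \<le> Ku"
    and v: "ivp_solution
      (\<lambda>t z. cutoff_extension A \<psi> f B Fhat z - \<mu> *\<^sub>R (I h z - I h (u t))) v0 v"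
  obtains K where "K > 0" "\<And>t. t \<ge> 0 \<Longrightarrow> norm (v t) \<le> K"
proof -
  interpret cutoff_assumptions A CI \<mu> Rext Rext' \<psi> B Fhat by fact
  obtain M where M: "\<And>z. cutoff_extension A \<psi> f B Fhat z \<bullet> z
      \<le> M + norm f * norm z - min_eigenvalue B * (norm z)\<^sup>2"
    using cutoff_extension_dissipative[OF cut] by blast
  define FM where "FM = cutoff_extension A \<psi> f B Fhat"
  show thesis
  proof (rule dissipative_bounded[OF B_dissipative])
    show "(v has_vector_derivative FM (v s) - \<mu> *\<^sub>R (I h (v s) - I h (u s))) (at s within {0..})"
      if "s \<ge> 0" for s
      using v that by (simp add: ivp_solution_def FM_def)
    show "(FM (v s) - \<mu> *\<^sub>R (I h (v s) - I h (u s))) \<bullet> v s \<le>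
        M + (norm f + \<mu> * CI * Ku) * norm (v s) - (min_eigenvalue B - \<mu> * CI) * (norm (v s))\<^sup>2"
      if s: "s \<ge> 0" for s
    proof -
      have "- (I h (v s) - I h (u s)) \<bullet> v s \<le> norm (- (I h (v s) - I h (u s))) * norm (v s)"
        by (rule norm_cauchy_schwarz)
      also have "\<dots> \<le> (CI * norm (v s) + CI * Ku) * norm (v s)"
      proof (rule mult_right_mono)
        have "norm (I h (u s)) \<le> CI * Ku"
          using I_bound[OF h_range, of "u s"] u[OF s] CI_pos
          by (meson mult_left_mono less_imp_le order_trans)
        then show "norm (- (I h (v s) - I h (u s))) \<le> CI * norm (v s) + CI * Ku"
          using I_bound[OF h_range, of "v s"] norm_triangle_ineq4[of "I h (v s)" "I h (u s)"]
          by (simp add: norm_minus_commute)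
      qed simp
      finally have "\<mu> * (- (I h (v s) - I h (u s)) \<bullet> v s)
          \<le> \<mu> * ((CI * norm (v s) + CI * Ku) * norm (v s))"
        using mu_pos by (intro mult_left_mono) auto
      then show ?thesis
        using M[of "v s"] by (simp add: FM_def inner_diff_left power2_eq_square algebra_simps)
    qed
  qed (rule that)
qed

text \<open>Pointwise energy estimate with \<open>z\<close> the truth, \<open>z'\<close> the
  surrogate state and \<open>r\<close>, \<open>r'\<close> their residuals. The increment
  \<open>r' - r\<close> costs decay rate through \<open>L\<close>, while the size of
  \<open>r\<close> at the truth sets the floor through \<open>e\<close>.\<close>

lemma nudging_error_dissipation:
  assumes "R > 0" "norm z \<le> R" "norm z' \<le> R" "\<mu> \<ge> 0"
    and nueff: "nueff = \<nu> - \<mu> * c0\<^sup>2 * h\<^sup>2 / 2" "nueff > 0"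
    and r: "norm r \<le> e" and r': "norm (r' - r) \<le> L * norm (z' - z)"
  shows "2 * ((drift \<nu> f A N z' + r' - \<mu> *\<^sub>R (I h z' - I h z) - drift \<nu> f A N z) \<bullet> (z' - z))
    \<le> e\<^sup>2 / (min_eigenvalue A * nueff) - (\<mu> - 2 * (CR R + L)) * (norm (z' - z))\<^sup>2"
proof -
  define w where "w = z' - z"
  define n where "n = norm w"
  define V where "V = vnorm A w"
  define lam where "lam = min_eigenvalue A"
  have n: "n \<ge> 0" "w \<bullet> w = n\<^sup>2"
    by (simp_all add: n_def power2_norm_eq_inner)
  have lam: "lam > 0" "lam * n\<^sup>2 \<le> V\<^sup>2"
    using min_eigenvalue_pos[OF A_spd] min_eigenvalue_vnorm_bound[OF A_spd, of w]
    by (simp_all add: lam_def n_def V_def)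
  have N: "- ((N z' - N z) \<bullet> w) \<le> CR R * n\<^sup>2"
    using N_monotone[OF assms(1-3)] by (simp add: w_def n_def)
  have A: "(A *v z' - A *v z) \<bullet> w = V\<^sup>2"
    by (simp add: V_def vnorm_power2[OF A_spd] w_def matrix_vector_mult_diff_distrib inner_commute)
  have res: "r' \<bullet> w \<le> L * n\<^sup>2 + e * n"
  proof -
    have "(r' - r) \<bullet> w \<le> L * n * n"
      using norm_cauchy_schwarz[of "r' - r" w] mult_right_mono[OF r', of n] n
      by (simp add: n_def w_def)
    moreover have "r \<bullet> w \<le> e * n"
      using norm_cauchy_schwarz[of r w] mult_right_mono[OF r, of n] n by (simp add: n_def)
    ultimately show ?thesis
      by (simp add: inner_diff_left power2_eq_square)
  qed
  \<comment> \<open>Writing \<open>I h w = w - (w - I h w)\<close> yields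
    \<open>- 2 * n\<^sup>2\<close> plus an interpolation error; the square of
    \<open>c0 * h * V - n\<close> trades one \<open>n\<^sup>2\<close> for a multiple of
    \<open>V\<^sup>2\<close>.\<close>
  have nudge: "- 2 * ((I h z' - I h z) \<bullet> w) \<le> - n\<^sup>2 + c0\<^sup>2 * h\<^sup>2 * V\<^sup>2"
  proof -
    have I: "I h z' - I h z = I h w"
      using I_linear[OF h_range] by (simp add: w_def linear_diff)
    have "(w - I h w) \<bullet> w \<le> norm (w - I h w) * n"
      unfolding n_def by (rule norm_cauchy_schwarz)
    also have "\<dots> \<le> c0 * h * V * n"
      using I_approx[OF h_range, of w] n by (intro mult_right_mono) (auto simp: V_def)
    finally have "(w - I h w) \<bullet> w \<le> c0 * h * V * n" .
    moreover have "0 \<le> (c0 * h * V - n)\<^sup>2"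
      by simp
    ultimately show ?thesis
      unfolding I by (simp add: inner_diff_left n power2_eq_square algebra_simps)
  qed
  \<comment> \<open>The weight \<open>lam * nueff\<close> makes the quadratic remainder
    \<open>nueff * (lam * n\<^sup>2)\<close>, at most \<open>nueff * V\<^sup>2\<close>. A second
    copy is added to match the available dissipation \<open>2 * nueff * V\<^sup>2\<close>.\<close>
  have young: "2 * e * n \<le> e\<^sup>2 / (lam * nueff) + 2 * nueff * V\<^sup>2"
  proof -
    have "0 \<le> (e - lam * nueff * n)\<^sup>2 / (lam * nueff)"
      using lam nueff by simp
    also have "\<dots> = e\<^sup>2 / (lam * nueff) - 2 * e * n + nueff * (lam * n\<^sup>2)"
      using lam nueff(2) by (simp add: power2_eq_square field_simps)
    finally have "2 * e * n \<le> e\<^sup>2 / (lam * nueff) + nueff * (lam * n\<^sup>2)"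
      by simp
    moreover have "nueff * (lam * n\<^sup>2) \<le> nueff * V\<^sup>2"
      using lam nueff(2) by (intro mult_left_mono) auto
    moreover have "0 \<le> nueff * V\<^sup>2"
      using nueff(2) by simp
    ultimately show ?thesis by linarith
  qed
  have "2 * ((drift \<nu> f A N z' + r' - \<mu> *\<^sub>R (I h z' - I h z) - drift \<nu> f A N z) \<bullet> w) =
      - 2 * \<nu> * ((A *v z' - A *v z) \<bullet> w) + 2 * (- ((N z' - N z) \<bullet> w)) + 2 * (r' \<bullet> w)
      + \<mu> * (- 2 * ((I h z' - I h z) \<bullet> w))"
    by (simp add: drift_def inner_diff_left inner_add_left algebra_simps)
  also have "\<dots> \<le> - 2 * \<nu> * V\<^sup>2 + 2 * (CR R * n\<^sup>2) + 2 * (L * n\<^sup>2 + e * n)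
      + \<mu> * (- n\<^sup>2 + c0\<^sup>2 * h\<^sup>2 * V\<^sup>2)"
    unfolding A using \<open>\<mu> \<ge> 0\<close> by (intro add_mono order_refl mult_left_mono N res nudge) auto
  \<comment> \<open>The origin of \<open>nueff\<close>: viscosity less the interpolation cost is
    \<open>2 * \<nu> - \<mu> * c0\<^sup>2 * h\<^sup>2 = 2 * nueff\<close>.\<close>
  also have "\<dots> = 2 * e * n - 2 * nueff * V\<^sup>2 - (\<mu> - 2 * (CR R + L)) * n\<^sup>2"
    by (simp add: nueff(1) algebra_simps)
  also have "\<dots> \<le> e\<^sup>2 / (lam * nueff) - (\<mu> - 2 * (CR R + L)) * n\<^sup>2"
    using young by simp
  finally show ?thesis
    by (simp add: w_def n_def lam_def)
qed

text \<open>From \<open>T\<close> on both trajectories lie in \<open>S\<close>, so the pointwise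
  estimate holds with constant coefficients and Gronwall's inequality started at \<open>T\<close>
  integrates it.\<close>

lemma nudging_error_bound:
  assumes "R > 0" "\<mu> \<ge> 0"
    and nueff: "nueff = \<nu> - \<mu> * c0\<^sup>2 * h\<^sup>2 / 2" "nueff > 0"
    and gamma: "\<gamma> = \<mu> - 2 * (CR R + L)" "\<gamma> > 0"
    and ball: "\<And>z. z \<in> S \<Longrightarrow> norm z \<le> R"
    and res: "\<And>z. z \<in> S \<Longrightarrow> norm (FM z - drift \<nu> f A N z) \<le> e"
    and lip: "\<And>z z'. z \<in> S \<Longrightarrow> z' \<in> S \<Longrightarrow>
      norm ((FM z' - drift \<nu> f A N z') - (FM z - drift \<nu> f A N z)) \<le> L * norm (z' - z)"
    and u: "ivp_solution (\<lambda>_. drift \<nu> f A N) u0 u"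
    and v: "ivp_solution (\<lambda>t z. FM z - \<mu> *\<^sub>R (I h z - I h (u t))) v0 v"
    and "T \<ge> 0" and absorbed: "\<And>t. t \<ge> T \<Longrightarrow> u t \<in> S" "\<And>t. t \<ge> T \<Longrightarrow> v t \<in> S"
    and "t \<ge> T"
  shows "(norm (v t - u t))\<^sup>2 \<le> exp (- \<gamma> * (t - T)) * (norm (v T - u T))\<^sup>2 +
    e\<^sup>2 / (min_eigenvalue A * nueff * \<gamma>) * (1 - exp (- \<gamma> * (t - T)))"
proof -
  define F where "F = drift \<nu> f A N"
  have "(norm (v t - u t))\<^sup>2 \<le> exp (- \<gamma> * (t - T)) * (norm (v T - u T))\<^sup>2 +
      e\<^sup>2 / (min_eigenvalue A * nueff) / \<gamma> * (1 - exp (- \<gamma> * (t - T)))"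
  proof (rule gronwall_decay_norm[where x = "\<lambda>t. v t - u t", OF gamma(2) _ _ \<open>t \<ge> T\<close>])
    fix s assume s: "s \<ge> T"
    have "(v has_vector_derivative FM (v s) - \<mu> *\<^sub>R (I h (v s) - I h (u s))) (at s within {0..})"
      "(u has_vector_derivative F (u s)) (at s within {0..})"
      using u v s \<open>T \<ge> 0\<close> by (auto simp: ivp_solution_def F_def)
    \<comment> \<open>\<open>FM (v s)\<close> is split into drift plus residual to fit the pointwise
      estimate.\<close>
    then show "((\<lambda>t. v t - u t) has_vector_derivative
        F (v s) + (FM (v s) - F (v s)) - \<mu> *\<^sub>R (I h (v s) - I h (u s)) - F (u s)) (at s within {T..})"
      using \<open>T \<ge> 0\<close>
      by (auto intro!: has_vector_derivative_diff elim!: has_vector_derivative_within_subset)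
    show "2 * ((F (v s) + (FM (v s) - F (v s)) - \<mu> *\<^sub>R (I h (v s) - I h (u s)) - F (u s)) \<bullet> (v s - u s))
        \<le> e\<^sup>2 / (min_eigenvalue A * nueff) - \<gamma> * (norm (v s - u s))\<^sup>2"
      unfolding gamma(1) F_def
      by (rule nudging_error_dissipation[where r = "FM (u s) - drift \<nu> f A N (u s)"])
        (use assms s in auto)
  qed
  then show ?thesis
    by simp
qed

end

section \<open>Long-time limit and the tracking result\<close>

lemma Limsup_le_of_decay:
  fixes g :: "real \<Rightarrow> real"
  assumes "\<gamma> > 0"
    and le: "\<And>t. t \<ge> T \<Longrightarrow> g t \<le> exp (- \<gamma> * (t - T)) * E + D * (1 - exp (- \<gamma> * (t - T)))"
  shows "Limsup at_top (\<lambda>t. ereal (g t)) \<le> ereal D"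
proof -
  have "((\<lambda>t. exp (- \<gamma> * (t - T)) * E + D * (1 - exp (- \<gamma> * (t - T)))) \<longlongrightarrow> 0 * E + D * (1 - 0)) at_top"
    using \<open>\<gamma> > 0\<close> by (intro tendsto_intros) real_asymp+
  then have "((\<lambda>t. ereal (exp (- \<gamma> * (t - T)) * E + D * (1 - exp (- \<gamma> * (t - T))))) \<longlongrightarrow> ereal D) at_top"
    by simp
  then have "Limsup at_top (\<lambda>t. ereal (exp (- \<gamma> * (t - T)) * E + D * (1 - exp (- \<gamma> * (t - T))))) = ereal D"
    by (intro lim_imp_Limsup) auto
  moreover have "Limsup at_top (\<lambda>t. ereal (g t))
      \<le> Limsup at_top (\<lambda>t. ereal (exp (- \<gamma> * (t - T)) * E + D * (1 - exp (- \<gamma> * (t - T)))))"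
    using le by (intro Limsup_mono) (auto simp: eventually_at_top_linorder)
  ultimately show ?thesis
    by simp
qed

text \<open>Absorption is asserted for each pair of trajectories with its own radius. Tracking then
  concerns any \<open>Rs \<le> Rext\<close> and any time \<open>Ts\<close> after which both
  trajectories stay in the ball of radius \<open>Rs\<close>.\<close>

theorem proposition4p1:
  fixes \<nu> \<alpha> \<beta> CE c0 CI h \<mu> Rext Rext' Rs Csq \<gamma> nueff lam1 :: real
    and f :: "real ^ 'n" and A B :: "real ^ 'n ^ 'n"
    and N F Fhat FM :: "real ^ 'n \<Rightarrow> real ^ 'n"
    and CR \<psi> :: "real \<Rightarrow> real" and I :: "real \<Rightarrow> real ^ 'n \<Rightarrow> real ^ 'n"
    and Bs :: "(real ^ 'n) set" and \<epsilon> \<eta> \<delta> l :: ereal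
  assumes "sym_pos_def A" and "Rs > 0" and Bs: "Bs = vball A Rs"
    and F: "F = drift \<nu> f A N" and "\<forall>z\<in>Bs. F differentiable (at z)"
    and "C1_on Bs Fhat"
    and "\<forall>z\<in>Bs. FM z = Fhat z"
    and eps: "\<epsilon> = sup_diff Bs Fhat F"
    and eta: "\<eta> = sup_deriv_diff Bs Fhat F"
    and delta: "\<delta> = sup_diff Bs FM F"
    and ell: "l = sup_diff_quotient Bs (\<lambda>z. FM z - F z)"
    and lam1: "lam1 = min_eigenvalue A"
    and Csq: "Csq = CR (Rs / sqrt lam1)"
    and gamma: "\<gamma> = \<mu> - 2 * (Csq + real_of_ereal \<eta>)"
    and nueff: "nueff = \<nu> - \<mu> * c0\<^sup>2 * h\<^sup>2 / 2"
  shows "\<delta> \<le> \<epsilon> \<and> l \<le> \<eta> \<and>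
    (structural_assumptions \<nu> A N \<alpha> \<beta> CE CR I c0 CI h \<and>
     cutoff_assumptions A CI \<mu> Rext Rext' \<psi> B Fhat \<and>
     FM = cutoff_extension A \<psi> f B Fhat \<longrightarrow>
       (\<forall>u0 v0 u v.
          ivp_solution (\<lambda>_. F) u0 u \<and>
          ivp_solution (\<lambda>t z. FM z - \<mu> *\<^sub>R (I h z - I h (u t))) v0 v \<longrightarrow>
          (\<exists>T\<ge>0. \<exists>R>0. \<forall>t\<ge>T. vnorm A (u t) \<le> R \<and> vnorm A (v t) \<le> R)) \<and>
       (Rs \<le> Rext \<and> ereal \<mu> > 2 * (ereal Csq + \<eta>) \<and> \<mu> * c0\<^sup>2 * h\<^sup>2 < \<nu> \<longrightarrow>
          \<epsilon> < \<infinity> \<and> \<delta> < \<infinity> \<and> l < \<infinity> \<and>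
          ereal \<mu> > 2 * (ereal Csq + l) \<and> \<mu> * c0\<^sup>2 * h\<^sup>2 < \<nu> \<and>
          (\<forall>u0 v0 u v Ts.
             ivp_solution (\<lambda>_. F) u0 u \<and>
             ivp_solution (\<lambda>t z. FM z - \<mu> *\<^sub>R (I h z - I h (u t))) v0 v \<and>
             Ts \<ge> 0 \<and> (\<forall>t\<ge>Ts. vnorm A (u t) \<le> Rs \<and> vnorm A (v t) \<le> Rs) \<longrightarrow>
             (\<forall>t\<ge>Ts. (norm (v t - u t))\<^sup>2 \<le>
                 exp (- \<gamma> * (t - Ts)) * (norm (v Ts - u Ts))\<^sup>2 +
                 (real_of_ereal \<epsilon>)\<^sup>2 / (lam1 * nueff * \<gamma>) * (1 - exp (- \<gamma> * (t - Ts)))) \<and>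
             Limsup at_top (\<lambda>t. ereal ((norm (v t - u t))\<^sup>2))
               \<le> ereal ((real_of_ereal \<epsilon>)\<^sup>2 / (lam1 * nueff * \<gamma>)))))"
proof -
  \<comment> \<open>The center makes the ball nonempty, which keeps the suprema over it
    nonnegative.\<close>
  have zero: "0 \<in> Bs"
    using \<open>Rs > 0\<close> by (simp add: Bs vball_def vnorm_def)
  have conv: "convex Bs"
    using assms(1,2) by (simp add: Bs convex_vball)
  have Fhat_diff: "Fhat differentiable (at z within Bs)" if "z \<in> Bs" for z
    using \<open>C1_on Bs Fhat\<close> that unfolding C1_on_def differentiable_def by blast
  have F_diff: "F differentiable (at z)" if "z \<in> Bs" for z
    using assms(5) that by blast
  have FM_eq: "FM z = Fhat z" if "z \<in> Bs" for z
    using assms(7) that by blast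
  have delta_eq: "\<delta> = \<epsilon>"
    unfolding delta eps sup_diff_def using FM_eq by (intro SUP_cong) auto
  have "l = sup_diff_quotient Bs (\<lambda>z. Fhat z - F z)"
    unfolding ell sup_diff_quotient_def using FM_eq by (intro SUP_cong) auto
  then have l_le: "l \<le> \<eta>"
    unfolding eta using conv zero Fhat_diff F_diff
    by (auto intro!: sup_diff_quotient_le_sup_deriv_diff)
  have eta_nonneg: "\<eta> \<ge> 0"
    unfolding eta using zero Fhat_diff F_diff by (intro sup_deriv_diff_nonneg)
  \<comment> \<open>Finiteness comes from compactness: both fields are differentiable, hence
    continuous, on the ball.\<close>
  have eps_fin: "\<epsilon> < \<infinity>"
    unfolding eps
  proof (rule sup_diff_finite)
    show "compact Bs"
      using assms(1) by (simp add: Bs compact_vball)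
    show "continuous_on Bs Fhat"
      using Fhat_diff differentiable_imp_continuous_within continuous_on_eq_continuous_within by blast
    show "continuous_on Bs F"
      using F_diff differentiable_imp_continuous_within continuous_at_imp_continuous_on by blast
  qed
  have eps_nonneg: "\<epsilon> \<ge> 0"
    unfolding eps using zero by (intro sup_diff_nonneg) auto
  have absorbing: "\<exists>T\<ge>0. \<exists>R>0. \<forall>t\<ge>T. vnorm A (u t) \<le> R \<and> vnorm A (v t) \<le> R"
    if struct: "structural_assumptions \<nu> A N \<alpha> \<beta> CE CR I c0 CI h"
      and cut: "cutoff_assumptions A CI \<mu> Rext Rext' \<psi> B Fhat"
      and FM: "FM = cutoff_extension A \<psi> f B Fhat"
      and u: "ivp_solution (\<lambda>_. F) u0 u"
      and v: "ivp_solution (\<lambda>t z. FM z - \<mu> *\<^sub>R (I h z - I h (u t))) v0 v"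
    for u0 v0 u v
  proof -
    interpret structural_assumptions \<nu> A N \<alpha> \<beta> CE CR I c0 CI h by fact
    obtain Ku where Ku: "Ku > 0" "\<And>t. t \<ge> 0 \<Longrightarrow> norm (u t) \<le> Ku"
      using drift_solution_bounded[OF u[unfolded F]] by blast
    obtain Kv where Kv: "Kv > 0" "\<And>t. t \<ge> 0 \<Longrightarrow> norm (v t) \<le> Kv"
      using nudged_solution_bounded[OF cut Ku(2) v[unfolded FM]] by blast
    obtain K where K: "K > 0" "\<And>z. vnorm A z \<le> K * norm z"
      using vnorm_le_norm[of A] by blast
    have "vnorm A z \<le> K * (Ku + Kv)" if "norm z \<le> Ku + Kv" for z
      using K that by (meson mult_left_mono less_imp_le order_trans)
    moreover have "norm (u t) \<le> Ku + Kv" "norm (v t) \<le> Ku + Kv" if "t \<ge> 0" for t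
      using Ku Kv that by (smt (verit))+
    \<comment> \<open>Both bounds hold from the start, so the entry time 0 works; \<open>K\<close>
      converts the common Euclidean bound \<open>Ku + Kv\<close> into an energy radius.\<close>
    ultimately show ?thesis
      using Ku(1) Kv(1) K(1) by (intro exI[of _ 0] conjI exI[of _ "K * (Ku + Kv)"]) auto
  qed
  have tracking: "(\<forall>t\<ge>Ts. (norm (v t - u t))\<^sup>2 \<le> exp (- \<gamma> * (t - Ts)) * (norm (v Ts - u Ts))\<^sup>2 +
        (real_of_ereal \<epsilon>)\<^sup>2 / (lam1 * nueff * \<gamma>) * (1 - exp (- \<gamma> * (t - Ts)))) \<and>
      Limsup at_top (\<lambda>t. ereal ((norm (v t - u t))\<^sup>2))
        \<le> ereal ((real_of_ereal \<epsilon>)\<^sup>2 / (lam1 * nueff * \<gamma>))"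
    if struct: "structural_assumptions \<nu> A N \<alpha> \<beta> CE CR I c0 CI h"
      and cut: "cutoff_assumptions A CI \<mu> Rext Rext' \<psi> B Fhat"
      and mu: "ereal \<mu> > 2 * (ereal Csq + \<eta>)" and nu: "\<mu> * c0\<^sup>2 * h\<^sup>2 < \<nu>"
      and u: "ivp_solution (\<lambda>_. F) u0 u"
      and v: "ivp_solution (\<lambda>t z. FM z - \<mu> *\<^sub>R (I h z - I h (u t))) v0 v"
      and Ts: "Ts \<ge> 0" and absorbed: "\<forall>t\<ge>Ts. vnorm A (u t) \<le> Rs \<and> vnorm A (v t) \<le> Rs"
    for u0 v0 u v Ts
  proof -
    interpret structural_assumptions \<nu> A N \<alpha> \<beta> CE CR I c0 CI h by fact
    interpret cutoff_assumptions A CI \<mu> Rext Rext' \<psi> B Fhat by fact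
    \<comment> \<open>The strict lower bound on \<open>\<mu>\<close> forces \<open>\<eta>\<close> to
      be finite, so \<open>real_of_ereal \<eta>\<close> in \<open>\<gamma>\<close> is its true value
      and not the default 0.\<close>
    obtain L where L: "\<eta> = ereal L"
      using mu eta_nonneg by (cases \<eta>) auto
    obtain e where e: "\<epsilon> = ereal e"
      using eps_fin eps_nonneg by (cases \<epsilon>) auto
    have gamma_pos: "\<gamma> > 0"
      using mu by (simp add: gamma L)
    have nueff_pos: "nueff > 0"
      using nu nu_pos by (simp add: nueff)
    have bound: "(norm (v t - u t))\<^sup>2 \<le> exp (- \<gamma> * (t - Ts)) * (norm (v Ts - u Ts))\<^sup>2 +
        (real_of_ereal \<epsilon>)\<^sup>2 / (lam1 * nueff * \<gamma>) * (1 - exp (- \<gamma> * (t - Ts)))" if "t \<ge> Ts" for t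
      unfolding lam1 e real_of_ereal.simps
    \<comment> \<open>The Euclidean ball of radius \<open>Rs / sqrt lam1\<close> contains
      \<open>Bs\<close>, and its monotonicity constant is \<open>Csq\<close>.\<close>
    proof (rule nudging_error_bound[where S = Bs and FM = FM and L = L and R = "Rs / sqrt lam1"])
      show "Rs / sqrt lam1 > 0"
        using \<open>Rs > 0\<close> min_eigenvalue_pos[OF A_spd] by (simp add: lam1)
      show "norm z \<le> Rs / sqrt lam1" if "z \<in> Bs" for z
        using norm_le_vnorm[OF A_spd, of z] that min_eigenvalue_pos[OF A_spd]
          divide_right_mono[of "vnorm A z" Rs "sqrt lam1"]
        by (simp add: Bs vball_def lam1)
      show "norm (FM z - drift \<nu> f A N z) \<le> e" if "z \<in> Bs" for z
      proof -
        have "ereal (norm (Fhat z - F z)) \<le> \<epsilon>"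
          unfolding eps sup_diff_def using that by (rule SUP_upper)
        then show ?thesis
          using that by (simp add: e FM_eq F)
      qed
      show "norm ((FM z' - drift \<nu> f A N z') - (FM z - drift \<nu> f A N z)) \<le> L * norm (z' - z)"
        if "z \<in> Bs" "z' \<in> Bs" for z z'
        using residual_lipschitz[OF conv Fhat_diff F_diff, of L z z'] that L
        by (simp add: eta FM_eq F)
      show "ivp_solution (\<lambda>_. drift \<nu> f A N) u0 u"
        using u by (simp add: F)
    qed (use v Ts absorbed that mu_pos nueff nueff_pos gamma gamma_pos Csq L in
        \<open>auto simp: Bs vball_def\<close>)
    then show ?thesis
      using Limsup_le_of_decay[OF gamma_pos, where g = "\<lambda>t. (norm (v t - u t))\<^sup>2"] by blast
  qed
  \<comment> \<open>Replacing \<open>\<eta>\<close> by \<open>l \<le> \<eta>\<close> only relaxes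
    the condition on \<open>\<mu>\<close>.\<close>
  have mu_l: "ereal \<mu> > 2 * (ereal Csq + l)" if "ereal \<mu> > 2 * (ereal Csq + \<eta>)"
    using l_le by (intro le_less_trans[OF _ that] ereal_mult_left_mono add_left_mono) auto
  have l_fin: "l < \<infinity>" if "ereal \<mu> > 2 * (ereal Csq + \<eta>)"
    using l_le that by (cases \<eta>) auto
  show ?thesis
    using delta_eq l_le eps_fin absorbing tracking mu_l l_fin by (intro conjI impI allI) blast+
qed

end
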